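(* Let $n\ge1$. If $\alpha\in\hat{\Psi}$, then $dS_{n+1}(f_\alpha)$ is isometric to a warped product of $(\mathbb{R},\beta\,dt\otimes dt)$ (base) and $(S^n,\Omega_n)$ (fiber), where $\beta:=(\alpha')^2-\alpha^2$ and the warping function is $\alpha\cosh t$.
   Context: $\mathbb{R}^{n+2}_1$ is $\mathbb{R}^{n+2}$ with metric $\eta=-dx^0\otimes dx^0+dx^1\otimes dx^1+\cdots+dx^{n+1}\otimes dx^{n+1}$. For a smooth function $f:(a,b)\to\mathbb{R}$ on an open interval (possibly unbounded), $dS_{n+1}(f)$ is the hypersurface $\{x\in\mathbb{R}^{n+2}_1 : x^0\in(a,b),\ -(x^0)^2+(x^1)^2+\cdots+(x^{n+1})^2=f(x^0)^2\}$ with the metric induced from $\eta$. $\Psi$ is the set of smooth functions $\alpha:\mathbb{R}\to\mathbb{R}$ with $\alpha(t)>0$ for all $t$ and such that $h(t):=\alpha(t)\sinh t$ has nonzero derivative for all $t$. $\hat{\Psi}$ is the set of $\alpha\in\Psi$ with $|\alpha'(t)|\neq\alpha(t)$ for all $t$. For $\alpha\in\Psi$, $f_\alpha:=\alpha\circ h^{-1}$ on the open interval $h(\mathbb{R})$. $\Omega_n$ is the round metric on the unit sphere $S^n$. Given pseudo-Riemannian manifolds $(B,g_B)$ and $(F,g_F)$ and a smooth function $k>0$ on $B$, the warped product $B\times_k F$ with warping function $k$ is $B\times F$ with metric $\pi_B^\ast g_B+(k\circ\pi_B)^2\pi_F^\ast g_F$, where $\pi_B,\pi_F$ are the projections. 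*)

theory Defs
  imports "HOL-Analysis.Analysis"
begin

section \<open>Smooth maps on open sets\<close>

text \<open>
  On an open subset of a Euclidean space this is the usual notion: all iterated partial
  derivatives exist and are continuous. The set is always meant to be open.
\<close>

primrec Ck_on :: "nat \<Rightarrow> 'a set \<Rightarrow> ('a::real_normed_vector \<Rightarrow> 'b::real_normed_vector) \<Rightarrow> bool" where
  "Ck_on 0 S f \<longleftrightarrow> continuous_on S f"
| "Ck_on (Suc k) S f \<longleftrightarrow>
     (\<forall>x\<in>S. f differentiable (at x)) \<and> (\<forall>v. Ck_on k S (\<lambda>x. frechet_derivative f (at x) v))"

definition smooth_on :: "'a set \<Rightarrow> ('a::real_normed_vector \<Rightarrow> 'b::real_normed_vector) \<Rightarrow> bool" where
  "smooth_on S f \<longleftrightarrow> (\<forall>k. Ck_on k S f)"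

section \<open>Embedded submanifolds of Euclidean spaces\<close>

definition submanifold :: "nat \<Rightarrow> 'a::euclidean_space set \<Rightarrow> bool" where
  "submanifold d M \<longleftrightarrow>
     (\<forall>p\<in>M. \<exists>U V \<phi> \<psi> W. open U \<and> p \<in> U \<and> open V \<and> homeomorphism U V \<phi> \<psi> \<and>
        smooth_on U \<phi> \<and> smooth_on V \<psi> \<and>
        subspace (W :: 'a set) \<and> dim W = d \<and> \<phi> ` (M \<inter> U) = V \<inter> W)"

text \<open>
  For an embedded submanifold, smoothness is the same as local extendability to a smooth map on
  an open subset of the ambient space.
\<close>

definition smooth_map_on ::
  "'a::euclidean_space set \<Rightarrow> ('a \<Rightarrow> 'b::euclidean_space) \<Rightarrow> bool" where
  "smooth_map_on M \<phi> \<longleftrightarrow>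
     (\<forall>p\<in>M. \<exists>U \<Phi>. open U \<and> p \<in> U \<and> smooth_on U \<Phi> \<and> (\<forall>x\<in>M \<inter> U. \<Phi> x = \<phi> x))"

definition curve_at ::
  "'a::euclidean_space set \<Rightarrow> 'a \<Rightarrow> 'a \<Rightarrow> (real \<Rightarrow> 'a) \<Rightarrow> bool" where
  "curve_at M p v c \<longleftrightarrow>
     (\<exists>\<epsilon>>0. smooth_on {-\<epsilon><..<\<epsilon>} c \<and> c ` {-\<epsilon><..<\<epsilon>} \<subseteq> M) \<and>
     c 0 = p \<and> (c has_vector_derivative v) (at 0)"

definition tangent_space :: "'a::euclidean_space set \<Rightarrow> 'a \<Rightarrow> 'a set" where
  "tangent_space M p = {v. \<exists>c. curve_at M p v c}"

definition differential_on ::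
  "'a::euclidean_space set \<Rightarrow> ('a \<Rightarrow> 'b::euclidean_space) \<Rightarrow> 'a \<Rightarrow> 'a \<Rightarrow> 'b" where
  "differential_on M \<phi> p v =
     (THE w. \<forall>c. curve_at M p v c \<longrightarrow> ((\<phi> \<circ> c) has_vector_derivative w) (at 0))"

definition diffeomorphism_on ::
  "'a::euclidean_space set \<Rightarrow> 'b::euclidean_space set \<Rightarrow> ('a \<Rightarrow> 'b) \<Rightarrow> bool" where
  "diffeomorphism_on M N \<phi> \<longleftrightarrow>
     bij_betw \<phi> M N \<and> smooth_map_on M \<phi> \<and> smooth_map_on N (inv_into M \<phi>)"

section \<open>Pseudo-Riemannian manifolds\<close>

text \<open>
  A set of points of the ambient space and a field of bilinear forms. Only the values
  of \<open>form M p\<close> on the tangent space at \<open>p\<close>, for points \<open>p\<close> of \<open>M\<close>, are relevant.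
\<close>

record 'a prm =
  points :: "'a set"
  form :: "'a \<Rightarrow> 'a \<Rightarrow> 'a \<Rightarrow> real"

definition smooth_vector_field :: "'a::euclidean_space set \<Rightarrow> ('a \<Rightarrow> 'a) \<Rightarrow> bool" where
  "smooth_vector_field M X \<longleftrightarrow> smooth_map_on M X \<and> (\<forall>p\<in>M. X p \<in> tangent_space M p)"

definition pseudo_riemannian :: "'a::euclidean_space prm \<Rightarrow> bool" where
  "pseudo_riemannian M \<longleftrightarrow>
     (\<exists>d. submanifold d (points M)) \<and>
     (\<forall>p\<in>points M. let T = tangent_space (points M) p; g = form M p in
        (\<forall>u\<in>T. \<forall>v\<in>T. \<forall>w\<in>T. \<forall>a b. g (a *\<^sub>R u + b *\<^sub>R v) w = a * g u w + b * g v w) \<and>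
        (\<forall>v\<in>T. \<forall>w\<in>T. g v w = g w v) \<and>
        (\<forall>v\<in>T. (\<forall>w\<in>T. g v w = 0) \<longrightarrow> v = 0)) \<and>
     (\<forall>X Y. smooth_vector_field (points M) X \<and> smooth_vector_field (points M) Y \<longrightarrow>
        smooth_map_on (points M) (\<lambda>p. form M p (X p) (Y p)))"

definition isometry ::
  "'a::euclidean_space prm \<Rightarrow> 'b::euclidean_space prm \<Rightarrow> ('a \<Rightarrow> 'b) \<Rightarrow> bool" where
  "isometry M N \<phi> \<longleftrightarrow>
     diffeomorphism_on (points M) (points N) \<phi> \<and>
     (\<forall>p\<in>points M. \<forall>v\<in>tangent_space (points M) p. \<forall>w\<in>tangent_space (points M) p.
        form N (\<phi> p) (differential_on (points M) \<phi> p v) (differential_on (points M) \<phi> p w)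
          = form M p v w)"

definition isometric :: "'a::euclidean_space prm \<Rightarrow> 'b::euclidean_space prm \<Rightarrow> bool" where
  "isometric M N \<longleftrightarrow> pseudo_riemannian M \<and> pseudo_riemannian N \<and> (\<exists>\<phi>. isometry M N \<phi>)"

text \<open>
  The differentials of the two projections of \<open>B \<times> F\<close> are the restrictions of \<open>fst\<close> and \<open>snd\<close>.
\<close>

definition warped_product ::
  "'a::euclidean_space prm \<Rightarrow> ('a \<Rightarrow> real) \<Rightarrow> 'b::euclidean_space prm \<Rightarrow> ('a \<times> 'b) prm" where
  "warped_product B k F =
     \<lparr>points = points B \<times> points F,
      form = (\<lambda>p v w. form B (fst p) (fst v) (fst w)
                    + (k (fst p))\<^sup>2 * form F (snd p) (snd v) (snd w))\<rparr>"

section \<open>The manifolds of the statement\<close>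

definition round_sphere :: "(real ^ 'm) prm" where
  "round_sphere = \<lparr>points = sphere 0 1, form = (\<lambda>p v w. v \<bullet> w)\<rparr>"

definition line_manifold :: "(real \<Rightarrow> real) \<Rightarrow> real prm" where
  "line_manifold \<beta> = \<lparr>points = UNIV, form = (\<lambda>t v w. \<beta> t * (v * w))\<rparr>"

text \<open>
  With \<open>CARD('m) = n + 1\<close>, the space \<open>\<real>\<^sup>n\<^sup>+\<^sup>2\<close> is \<open>real \<times> (real ^ 'm)\<close>; the first component is the
  coordinate with the negative sign.
\<close>

definition minkowski :: "real \<times> (real ^ 'm) \<Rightarrow> real \<times> (real ^ 'm) \<Rightarrow> real" where
  "minkowski v w = - (fst v * fst w) + (\<Sum>i\<in>UNIV. snd v $ i * snd w $ i)"

text \<open>\<open>I\<close> is the open interval on which \<open>f\<close> is defined; values of \<open>f\<close> outside \<open>I\<close> do not matter.\<close>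

definition dS :: "real set \<Rightarrow> (real \<Rightarrow> real) \<Rightarrow> (real \<times> (real ^ 'm)) prm" where
  "dS I f = \<lparr>points = {x. fst x \<in> I \<and> minkowski x x = (f (fst x))\<^sup>2},
             form = (\<lambda>p. minkowski)\<rparr>"

definition h_of :: "(real \<Rightarrow> real) \<Rightarrow> real \<Rightarrow> real" where
  "h_of \<alpha> t = \<alpha> t * sinh t"

definition Psi :: "(real \<Rightarrow> real) set" where
  "Psi = {\<alpha>. smooth_on UNIV \<alpha> \<and> (\<forall>t. \<alpha> t > 0) \<and> (\<forall>t. deriv (h_of \<alpha>) t \<noteq> 0)}"

definition Psi_hat :: "(real \<Rightarrow> real) set" where
  "Psi_hat = {\<alpha> \<in> Psi. \<forall>t. \<bar>deriv \<alpha> t\<bar> \<noteq> \<alpha> t}"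

text \<open>
  To be used on \<open>range (h_of \<alpha>)\<close> only; \<open>h_of \<alpha>\<close> is injective for \<open>\<alpha> \<in> Psi\<close>.
\<close>

definition f_of :: "(real \<Rightarrow> real) \<Rightarrow> real \<Rightarrow> real" where
  "f_of \<alpha> = \<alpha> \<circ> inv (h_of \<alpha>)"

end

theory Submission
  imports Defs
begin

text \<open>
  Write \<open>h t = \<alpha> t * sinh t\<close> and \<open>k t = \<alpha> t * cosh t\<close>. For fixed time \<open>h t\<close> the slice of the
  hypersurface is the round sphere with squared radius \<open>(h t)\<^sup>2 + (\<alpha> t)\<^sup>2 = (k t)\<^sup>2\<close>, because
  \<open>cosh\<^sup>2 - sinh\<^sup>2 = 1\<close>. So \<open>(t, z) \<mapsto> (h t, k t z)\<close> maps \<open>\<real> \<times> S\<^sup>n\<close> onto it. The pulled back metric has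
  \<open>k\<^sup>2\<close> times the round metric on the sphere directions, no mixed terms since \<open>z\<close> is orthogonal
  to the tangent space of the sphere at \<open>z\<close>, and the coefficient
  \<open>(k')\<^sup>2 - (h')\<^sup>2 = (\<alpha>')\<^sup>2 - \<alpha>\<^sup>2\<close> of \<open>dt\<^sup>2\<close>, again by \<open>cosh\<^sup>2 - sinh\<^sup>2 = 1\<close>. This is
  \<open>minkowski_derivative_dS_param\<close>.

  The same formula, read for all \<open>z\<close> in the ambient space, is a diffeomorphism from
  \<open>\<real> \<times> \<real>\<^sup>n\<^sup>+\<^sup>1\<close> onto the open set \<open>range h \<times> \<real>\<^sup>n\<^sup>+\<^sup>1\<close> (\<open>ambient_diffeo_dS_param\<close>): \<open>h'\<close> has no zero, so
  \<open>h\<close> has a smooth inverse, and \<open>k\<close> is positive. Such an ambient diffeomorphism carries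
  submanifold charts, smooth curves and tangent vectors from one side to the other. Hence
  everything that has to be known about the hypersurface, including the nondegeneracy of its
  metric, is transported from the product (\<open>isometric_ambient_diffeo\<close>); no tangent space of the
  hypersurface is ever computed. On the product, nondegeneracy holds because both components of
  a tangent vector are themselves tangent vectors and \<open>\<beta>\<close> and \<open>k\<close> have no zeros.
\<close>

section \<open>Calculus of smooth maps\<close>

lemma Ck_on_imp_continuous_on: "Ck_on k S f \<Longrightarrow> continuous_on S f"
  by (cases k) (simp_all add: continuous_at_imp_continuous_on differentiable_imp_continuous_within)

lemma Ck_on_SucD: "Ck_on (Suc k) S f \<Longrightarrow> Ck_on k S f"
proof (induction k arbitrary: f)
  case 0
  then show ?case using Ck_on_imp_continuous_on[of "Suc 0" S f] by simp
next
  case (Suc k)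
  then show ?case by (metis Ck_on.simps(2))
qed

lemma Ck_on_cong:
  assumes "open S" and "\<And>x. x \<in> S \<Longrightarrow> f x = g x" and "Ck_on k S f"
  shows "Ck_on k S g"
  using assms(2,3)
proof (induction k arbitrary: f g)
  case 0
  then show ?case by (auto cong: continuous_on_cong)
next
  case (Suc k)
  have diff: "g differentiable (at x)"
    and eq: "frechet_derivative f (at x) = frechet_derivative g (at x)" if "x \<in> S" for x
  proof -
    have "f differentiable (at x)" using Suc.prems that by simp
    then show "frechet_derivative f (at x) = frechet_derivative g (at x)"
      by (rule frechet_derivative_transform_within_open[OF _ \<open>open S\<close> that Suc.prems(1)])
    show "g differentiable (at x)"
      using \<open>f differentiable (at x)\<close> unfolding differentiable_def
      by (meson has_derivative_transform_within_open \<open>open S\<close> that Suc.prems(1))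
  qed
  show ?case
    unfolding Ck_on.simps
  proof (intro conjI ballI allI)
    fix v
    show "Ck_on k S (\<lambda>x. frechet_derivative g (at x) v)"
      by (rule Suc.IH[of "\<lambda>x. frechet_derivative f (at x) v"]) (use eq Suc.prems(2) in auto)
  qed (rule diff)
qed

text \<open>
  In inductions on \<open>k\<close> the derivative is usually known by a formula on \<open>S\<close> only, and it is more
  convenient to supply that formula than to rewrite \<^const>\<open>frechet_derivative\<close>.
\<close>

lemma Ck_on_SucI:
  assumes "open S" and der: "\<And>x. x \<in> S \<Longrightarrow> (f has_derivative f' x) (at x)"
    and Ck: "\<And>v. Ck_on k S (\<lambda>x. f' x v)"
  shows "Ck_on (Suc k) S f"
  unfolding Ck_on.simps
proof (intro conjI ballI allI)
  fix x assume "x \<in> S"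
  with der show "f differentiable (at x)" unfolding differentiable_def by blast
next
  fix v
  show "Ck_on k S (\<lambda>x. frechet_derivative f (at x) v)"
    by (rule Ck_on_cong[OF \<open>open S\<close> _ Ck]) (use frechet_derivative_at[OF der] in simp)
qed

lemma Ck_on_SucE:
  assumes "Ck_on (Suc k) S f"
  obtains f' where "\<And>x. x \<in> S \<Longrightarrow> (f has_derivative f' x) (at x)"
    and "\<And>v. Ck_on k S (\<lambda>x. f' x v)"
proof
  show "(f has_derivative frechet_derivative f (at x)) (at x)" if "x \<in> S" for x
    using assms that by (simp add: frechet_derivative_works)
  show "Ck_on k S (\<lambda>x. frechet_derivative f (at x) v)" for v
    using assms by simp
qed

lemma Ck_on_const: "Ck_on k S (\<lambda>x. c)"
  by (induction k arbitrary: c) auto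

lemma Ck_on_linear:
  assumes "bounded_linear L" and "open S" and "Ck_on k S f"
  shows "Ck_on k S (\<lambda>x. L (f x))"
  using assms(3)
proof (induction k arbitrary: f)
  case 0
  then show ?case using bounded_linear.continuous_on[OF assms(1)] by simp
next
  case (Suc k)
  from Suc.prems obtain f' where f':
    "\<And>x. x \<in> S \<Longrightarrow> (f has_derivative f' x) (at x)" "\<And>v. Ck_on k S (\<lambda>x. f' x v)"
    by (rule Ck_on_SucE) blast
  show ?case
    by (rule Ck_on_SucI[OF \<open>open S\<close>, where f' = "\<lambda>x v. L (f' x v)"])
      (simp_all add: f' bounded_linear.has_derivative[OF assms(1)] Suc.IH)
qed

lemma Ck_on_ident:
  assumes "open S" shows "Ck_on k S (\<lambda>x. x)"
proof (cases k)
  case 0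
  then show ?thesis by simp
next
  case (Suc l)
  then show ?thesis
    using Ck_on_SucI[OF assms has_derivative_ident Ck_on_const] by simp
qed

lemma Ck_on_add:
  assumes "open S" and "Ck_on k S f" and "Ck_on k S g"
  shows "Ck_on k S (\<lambda>x. f x + g x)"
  using assms(2,3)
proof (induction k arbitrary: f g)
  case 0
  then show ?case by (simp add: continuous_on_add)
next
  case (Suc k)
  from Suc.prems(1) obtain f' where f':
    "\<And>x. x \<in> S \<Longrightarrow> (f has_derivative f' x) (at x)" "\<And>v. Ck_on k S (\<lambda>x. f' x v)"
    by (rule Ck_on_SucE) blast
  from Suc.prems(2) obtain g' where g':
    "\<And>x. x \<in> S \<Longrightarrow> (g has_derivative g' x) (at x)" "\<And>v. Ck_on k S (\<lambda>x. g' x v)"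
    by (rule Ck_on_SucE) blast
  show ?case
    by (rule Ck_on_SucI[OF \<open>open S\<close>, where f' = "\<lambda>x v. f' x v + g' x v"])
      (simp_all add: f' g' Suc.IH has_derivative_add)
qed

lemma Ck_on_sum:
  assumes "open S" and "finite A" and "\<And>a. a \<in> A \<Longrightarrow> Ck_on k S (f a)"
  shows "Ck_on k S (\<lambda>x. \<Sum>a\<in>A. f a x)"
  using assms(2,3)
proof (induction A rule: finite_induct)
  case empty
  then show ?case by (simp add: Ck_on_const)
next
  case (insert a A)
  then have "Ck_on k S (\<lambda>x. f a x + (\<Sum>b\<in>A. f b x))"
    by (intro Ck_on_add[OF \<open>open S\<close>]) simp_all
  with insert.hyps show ?case by simp
qed

lemma Ck_on_bilinear:
  assumes "bounded_bilinear B" and "open S" and "Ck_on k S f" and "Ck_on k S g"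
  shows "Ck_on k S (\<lambda>x. B (f x) (g x))"
  using assms(3,4)
proof (induction k arbitrary: f g)
  case 0
  then show ?case using bounded_bilinear.continuous_on[OF assms(1)] by simp
next
  case (Suc k)
  from Suc.prems(1) obtain f' where f':
    "\<And>x. x \<in> S \<Longrightarrow> (f has_derivative f' x) (at x)" "\<And>v. Ck_on k S (\<lambda>x. f' x v)"
    by (rule Ck_on_SucE) blast
  from Suc.prems(2) obtain g' where g':
    "\<And>x. x \<in> S \<Longrightarrow> (g has_derivative g' x) (at x)" "\<And>v. Ck_on k S (\<lambda>x. g' x v)"
    by (rule Ck_on_SucE) blast
  show ?case
  proof (rule Ck_on_SucI[OF \<open>open S\<close>, where f' = "\<lambda>x v. B (f x) (g' x v) + B (f' x v) (g x)"])
    show "((\<lambda>x. B (f x) (g x)) has_derivative (\<lambda>v. B (f x) (g' x v) + B (f' x v) (g x))) (at x)"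
      if "x \<in> S" for x
      by (rule bounded_bilinear.FDERIV[OF assms(1) f'(1)[OF that] g'(1)[OF that]])
    show "Ck_on k S (\<lambda>x. B (f x) (g' x v) + B (f' x v) (g x))" for v
      by (intro Ck_on_add \<open>open S\<close> Suc.IH f' g' Ck_on_SucD[OF Suc.prems(1)]
            Ck_on_SucD[OF Suc.prems(2)])
  qed
qed

text \<open>
  The chain rule produces \<open>g' (f x) (f' x v)\<close>, in which the direction also depends on \<open>x\<close>, whereas
  \<^const>\<open>Ck_on\<close> controls derivatives in fixed directions only. Expanding \<open>f' x v\<close> in a
  basis turns it into a sum of products of functions with a fixed direction; this is where finite
  dimension of the middle space enters.
\<close>

lemma Ck_on_compose:
  fixes f :: "'a::real_normed_vector \<Rightarrow> 'b::euclidean_space"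
  assumes "open S" and "open T" and "f ` S \<subseteq> T" and "Ck_on k S f" and "Ck_on k T g"
  shows "Ck_on k S (\<lambda>x. g (f x))"
  using assms(4,5)
proof (induction k arbitrary: g)
  case 0
  then show ?case using continuous_on_compose2[of T g S f] assms(3) by simp
next
  case (Suc k)
  from Suc.prems(1) obtain f' where f':
    "\<And>x. x \<in> S \<Longrightarrow> (f has_derivative f' x) (at x)" "\<And>v. Ck_on k S (\<lambda>x. f' x v)"
    by (rule Ck_on_SucE) blast
  from Suc.prems(2) obtain g' where g':
    "\<And>x. x \<in> T \<Longrightarrow> (g has_derivative g' x) (at x)" "\<And>v. Ck_on k T (\<lambda>x. g' x v)"
    by (rule Ck_on_SucE) blast
  show ?case
  proof (rule Ck_on_SucI[OF \<open>open S\<close>,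
      where f' = "\<lambda>x v. \<Sum>b\<in>Basis. (f' x v \<bullet> b) *\<^sub>R g' (f x) b"])
    fix x assume "x \<in> S"
    then have gd: "(g has_derivative g' (f x)) (at (f x))"
      using assms(3) g' by blast
    have "g' (f x) w = (\<Sum>b\<in>Basis. (w \<bullet> b) *\<^sub>R g' (f x) b)" for w
    proof -
      have lin: "linear (g' (f x))" using gd has_derivative_linear by blast
      have "g' (f x) w = g' (f x) (\<Sum>b\<in>Basis. (w \<bullet> b) *\<^sub>R b)"
        by (simp add: euclidean_representation)
      also have "\<dots> = (\<Sum>b\<in>Basis. (w \<bullet> b) *\<^sub>R g' (f x) b)"
        by (simp add: linear_sum[OF lin] linear_cmul[OF lin])
      finally show ?thesis .
    qed
    then have "(\<lambda>v. g' (f x) (f' x v)) = (\<lambda>v. \<Sum>b\<in>Basis. (f' x v \<bullet> b) *\<^sub>R g' (f x) b)"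
      by (intro ext)
    with has_derivative_compose[OF f'(1)[OF \<open>x \<in> S\<close>] gd]
    show "((\<lambda>x. g (f x)) has_derivative
        (\<lambda>v. \<Sum>b\<in>Basis. (f' x v \<bullet> b) *\<^sub>R g' (f x) b)) (at x)"
      by (rule back_subst)
  next
    fix v
    have "Ck_on k S (\<lambda>x. (f' x v \<bullet> b) *\<^sub>R g' (f x) b)" for b
      by (rule Ck_on_bilinear[OF bounded_bilinear_scaleR \<open>open S\<close>
            Ck_on_linear[OF bounded_linear_inner_left \<open>open S\<close> f'(2)]
            Suc.IH[OF Ck_on_SucD[OF Suc.prems(1)] g'(2)]])
    then show "Ck_on k S (\<lambda>x. \<Sum>b\<in>Basis. (f' x v \<bullet> b) *\<^sub>R g' (f x) b)"
      by (rule Ck_on_sum[OF \<open>open S\<close> finite_Basis])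
  qed
qed

lemma Ck_on_SucI_real:
  fixes f :: "real \<Rightarrow> real"
  assumes "open S" and "\<And>x. x \<in> S \<Longrightarrow> (f has_field_derivative f' x) (at x)" and "Ck_on k S f'"
  shows "Ck_on (Suc k) S f"
proof (rule Ck_on_SucI[OF \<open>open S\<close>, where f' = "\<lambda>x v. f' x * v"])
  show "(f has_derivative (*) (f' x)) (at x)" if "x \<in> S" for x
    using assms(2)[OF that] by (simp add: has_field_derivative_def)
  show "Ck_on k S (\<lambda>x. f' x * v)" for v
    by (rule Ck_on_linear[OF bounded_linear_mult_left assms(1,3)])
qed

lemma smooth_on_imp_continuous_on: "smooth_on S f \<Longrightarrow> continuous_on S f"
  unfolding smooth_on_def using Ck_on_imp_continuous_on by blast

lemma smooth_on_has_derivative: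
  assumes "smooth_on S f" "x \<in> S"
  shows "(f has_derivative frechet_derivative f (at x)) (at x)"
  using assms(1)[unfolded smooth_on_def, rule_format, of "Suc 0"] assms(2)
  by (simp add: frechet_derivative_works)

lemma Ck_on_subset: "Ck_on k S f \<Longrightarrow> T \<subseteq> S \<Longrightarrow> Ck_on k T f"
proof (induction k arbitrary: f)
  case 0
  then show ?case using continuous_on_subset by simp
next
  case (Suc k)
  then show ?case unfolding Ck_on.simps by blast
qed

lemma smooth_on_subset: "smooth_on S f \<Longrightarrow> T \<subseteq> S \<Longrightarrow> smooth_on T f"
  unfolding smooth_on_def using Ck_on_subset by blast

lemma smooth_on_const: "smooth_on S (\<lambda>x. c)"
  unfolding smooth_on_def by (simp add: Ck_on_const)

lemma smooth_on_ident: "open S \<Longrightarrow> smooth_on S (\<lambda>x. x)"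
  unfolding smooth_on_def by (simp add: Ck_on_ident)

lemma smooth_on_linear:
  "bounded_linear L \<Longrightarrow> open S \<Longrightarrow> smooth_on S f \<Longrightarrow> smooth_on S (\<lambda>x. L (f x))"
  unfolding smooth_on_def using Ck_on_linear[of L S _ f] by blast

lemma smooth_on_add:
  "open S \<Longrightarrow> smooth_on S f \<Longrightarrow> smooth_on S g \<Longrightarrow> smooth_on S (\<lambda>x. f x + g x)"
  unfolding smooth_on_def using Ck_on_add[of S _ f g] by blast

lemma smooth_on_diff:
  "open S \<Longrightarrow> smooth_on S f \<Longrightarrow> smooth_on S g \<Longrightarrow> smooth_on S (\<lambda>x. f x - g x)"
  using smooth_on_add[of S f "\<lambda>x. - g x"] smooth_on_linear[OF bounded_linear_minus[OF bounded_linear_ident], of S g]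
  by simp

lemma smooth_on_bilinear:
  "bounded_bilinear B \<Longrightarrow> open S \<Longrightarrow> smooth_on S f \<Longrightarrow> smooth_on S g \<Longrightarrow> smooth_on S (\<lambda>x. B (f x) (g x))"
  unfolding smooth_on_def using Ck_on_bilinear[of B S _ f g] by blast

lemmas smooth_on_mult = smooth_on_bilinear[OF bounded_bilinear_mult]
  and smooth_on_scaleR = smooth_on_bilinear[OF bounded_bilinear_scaleR]
  and smooth_on_inner = smooth_on_bilinear[OF bounded_bilinear_inner]

lemma smooth_on_Pair:
  assumes "open S" and "smooth_on S f" and "smooth_on S g"
  shows "smooth_on S (\<lambda>x. (f x, g x))"
proof -
  have 1: "bounded_linear (\<lambda>y. (y, 0))" and 2: "bounded_linear (\<lambda>y. (0, y))"
    by (intro bounded_linear_Pair bounded_linear_ident bounded_linear_zero)+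
  have "smooth_on S (\<lambda>x. (f x, 0) + (0, g x))"
    by (rule smooth_on_add[OF assms(1)
          smooth_on_linear[OF 1 assms(1,2)] smooth_on_linear[OF 2 assms(1,3)]])
  then show ?thesis by simp
qed

lemma smooth_on_compose:
  fixes f :: "'a::real_normed_vector \<Rightarrow> 'b::euclidean_space"
  shows "open S \<Longrightarrow> open T \<Longrightarrow> f ` S \<subseteq> T \<Longrightarrow> smooth_on S f \<Longrightarrow> smooth_on T g \<Longrightarrow>
    smooth_on S (\<lambda>x. g (f x))"
  unfolding smooth_on_def using Ck_on_compose[of S T f _ g] by blast

lemma smooth_on_deriv:
  fixes f :: "real \<Rightarrow> real"
  assumes "smooth_on UNIV f"
  shows "(f has_field_derivative deriv f t) (at t)" and "smooth_on UNIV (deriv f)"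
proof -
  have D: "(f has_derivative frechet_derivative f (at t)) (at t)" for t
    using smooth_on_has_derivative[OF assms] by simp
  have eq: "frechet_derivative f (at t) v = v * deriv f t" 
    and "(f has_field_derivative deriv f t) (at t)" for t v
  proof -
    have lin: "frechet_derivative f (at t) = (*) (frechet_derivative f (at t) 1)"
    proof
      show "frechet_derivative f (at t) v = frechet_derivative f (at t) 1 * v" for v
        using linear_cmul[OF has_derivative_linear[OF D[of t]], of v 1] by simp
    qed
    then have F: "(f has_field_derivative frechet_derivative f (at t) 1) (at t)"
      using D[of t] by (simp add: has_field_derivative_def)
    then have "deriv f t = frechet_derivative f (at t) 1"
      by (rule DERIV_imp_deriv)
    with F show "(f has_field_derivative deriv f t) (at t)" by simp
    show "frechet_derivative f (at t) v = v * deriv f t"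
      using fun_cong[OF lin, of v] \<open>deriv f t = _\<close> by simp
  qed
  then show "(f has_field_derivative deriv f t) (at t)" by simp
  show "smooth_on UNIV (deriv f)"
    unfolding smooth_on_def
  proof
    fix k
    have "Ck_on (Suc k) UNIV f" using assms smooth_on_def by blast
    then have "Ck_on k UNIV (\<lambda>t. frechet_derivative f (at t) 1)"
      unfolding Ck_on.simps by blast
    then show "Ck_on k UNIV (deriv f)" by (simp add: eq)
  qed
qed

lemma smooth_on_sinh_cosh: "smooth_on (UNIV :: real set) sinh" "smooth_on (UNIV :: real set) cosh"
proof -
  have "Ck_on k (UNIV :: real set) sinh \<and> Ck_on k (UNIV :: real set) cosh" for k
  proof (induction k)
    case 0
    then show ?case by (auto intro!: continuous_intros)
  next
    case (Suc k)
    then have "Ck_on k (UNIV :: real set) sinh" "Ck_on k (UNIV :: real set) cosh" by auto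
    then have "Ck_on (Suc k) (UNIV :: real set) sinh" "Ck_on (Suc k) (UNIV :: real set) cosh"
      using Ck_on_SucI_real[OF open_UNIV, of sinh cosh k] Ck_on_SucI_real[OF open_UNIV, of cosh sinh k] 
        has_field_derivative_sinh[OF DERIV_ident[where F = "at (_ :: real)"]]
        has_field_derivative_cosh[OF DERIV_ident[where F = "at (_ :: real)"]]
      by (simp_all del: Ck_on.simps)
    then show ?case by blast
  qed
  then show "smooth_on (UNIV :: real set) sinh" "smooth_on (UNIV :: real set) cosh"
    by (simp_all add: smooth_on_def)
qed

lemma smooth_on_inverse: "smooth_on (- {0 :: real}) inverse"
  unfolding smooth_on_def
proof
  fix k show "Ck_on k (- {0 :: real}) inverse"
  proof (induction k)
    case 0
    then show ?case by (auto intro!: continuous_intros)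
  next
    case (Suc k)
    show ?case
    proof (rule Ck_on_SucI_real)
      show "Ck_on k (- {0}) (\<lambda>x::real. - (inverse x * inverse x))"
        by (rule Ck_on_linear[OF bounded_linear_minus[OF bounded_linear_ident] _
              Ck_on_bilinear[OF bounded_bilinear_mult _ Suc Suc]]) auto
      show "(inverse has_field_derivative - (inverse x * inverse x)) (at x)" if "x \<in> - {0}"
        for x :: real
        using DERIV_inverse[of x UNIV] that by (simp add: power2_eq_square)
    qed auto
  qed
qed

lemma smooth_on_sqrt: "smooth_on {0<..} sqrt"
  unfolding smooth_on_def
proof
  fix k show "Ck_on k {0<..} sqrt"
  proof (induction k)
    case 0
    then show ?case by (auto intro!: continuous_intros)
  next
    case (Suc k)
    show ?case
    proof (rule Ck_on_SucI_real)
      show "Ck_on k {0<..} (\<lambda>x. inverse (sqrt x) / 2)"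
      proof (rule Ck_on_linear[OF bounded_linear_divide open_greaterThan])
        show "Ck_on k {0<..} (\<lambda>x. inverse (sqrt x))"
        proof (rule Ck_on_compose[OF open_greaterThan _ _ Suc, where T = "- {0}" and g = inverse])
          show "Ck_on k (- {0 :: real}) inverse"
            using smooth_on_inverse unfolding smooth_on_def by blast
        qed auto
      qed
      show "(sqrt has_field_derivative inverse (sqrt x) / 2) (at x)" if "x \<in> {0<..}" for x
        using DERIV_real_sqrt that by simp
    qed auto
  qed
qed

text \<open>
  The derivative of the inverse is \<open>1 / h'\<close> composed with the inverse, so each order of
  differentiability of the inverse yields the next one.
\<close>

lemma smooth_inverse_function:
  fixes h :: "real \<Rightarrow> real"
  assumes "smooth_on UNIV h" and nz: "\<And>t. deriv h t \<noteq> 0"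
  shows "inj h" and "open (range h)" and "smooth_on (range h) (inv h)"
proof -
  note D = smooth_on_deriv(1)[OF assms(1)]
  have neq: "h a \<noteq> h b" if ab: "a < b" for a b
  proof -
    obtain z where "h b - h a = (b - a) * deriv h z"
      using MVT2[OF ab D] by blast
    moreover have "(b - a) * deriv h z \<noteq> 0" using ab nz[of z] by simp
    ultimately show ?thesis by auto
  qed
  show inj: "inj h"
  proof (rule injI)
    fix a b assume "h a = h b"
    then show "a = b" using neq[of a b] neq[of b a] by (cases a b rule: linorder_cases) auto
  qed
  have cont: "continuous_on UNIV h" by (rule smooth_on_imp_continuous_on[OF assms(1)])
  have open_map: "open (h ` T)" if "open T" for T
    using iffD1[OF injective_eq_1d_open_map_UNIV[OF cont is_interval_univ] inj] that by simp
  show op: "open (range h)" by (rule open_map[OF open_UNIV])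
  have cont_inv: "continuous_on (range h) (inv h)"
  proof (rule continuous_on_inverse_open_map[OF cont refl])
    show "inv h (h t) = t" for t using inj by simp
    show "openin (top_of_set (range h)) (h ` T)" if "openin (top_of_set UNIV) T" for T
      using open_map[of T] that by (simp add: openin_open_eq[OF op] image_mono)
  qed
  have DI: "(inv h has_field_derivative inverse (deriv h (inv h s))) (at s)"
    if "s \<in> range h" for s
  proof (rule has_field_derivative_inverse_basic[OF D nz _ op that])
    show "isCont (inv h) s"
      using cont_inv that by (simp only: continuous_on_eq_continuous_at[OF op])
    show "h (inv h z) = z" if "z \<in> range h" for z
      using that by (rule f_inv_into_f)
  qed
  show "smooth_on (range h) (inv h)"
    unfolding smooth_on_def
  proof
    fix k show "Ck_on k (range h) (inv h)"
    proof (induction k)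
      case 0
      show ?case unfolding Ck_on.simps by (rule cont_inv)
    next
      case (Suc k)
      show ?case
      proof (rule Ck_on_SucI_real[OF op DI])
        show "Ck_on k (range h) (\<lambda>s. inverse (deriv h (inv h s)))"
        proof (rule Ck_on_compose[OF op, where T = "- {0}" and g = inverse])
          show "Ck_on k (range h) (\<lambda>s. deriv h (inv h s))"
          proof (rule Ck_on_compose[OF op open_UNIV subset_UNIV Suc, where g = "deriv h"])
            show "Ck_on k UNIV (deriv h)"
              using smooth_on_deriv(2)[OF assms(1)] unfolding smooth_on_def by blast
          qed
          show "Ck_on k (- {0 :: real}) inverse"
            using smooth_on_inverse unfolding smooth_on_def by blast
        qed (use nz in auto)
      qed
    qed
  qed
qed

section \<open>Ambient diffeomorphisms and submanifolds\<close>

text \<open>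
  Exactly the conditions on the maps of a chart in \<^const>\<open>submanifold\<close>.
\<close>

definition ambient_diffeo ::
  "'a::euclidean_space set \<Rightarrow> 'b::euclidean_space set \<Rightarrow> ('a \<Rightarrow> 'b) \<Rightarrow> ('b \<Rightarrow> 'a) \<Rightarrow> bool" where
  "ambient_diffeo U V F G \<longleftrightarrow>
     open U \<and> open V \<and> homeomorphism U V F G \<and> smooth_on U F \<and> smooth_on V G"

lemma ambient_diffeoI:
  assumes "open U" "open V" "smooth_on U F" "smooth_on V G"
    and "F ` U \<subseteq> V" "G ` V \<subseteq> U" "\<And>x. x \<in> U \<Longrightarrow> G (F x) = x" "\<And>y. y \<in> V \<Longrightarrow> F (G y) = y"
  shows "ambient_diffeo U V F G"
  unfolding ambient_diffeo_def using assms by (auto intro!: homeomorphismI smooth_on_imp_continuous_on)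

lemma ambient_diffeoD:
  assumes "ambient_diffeo U V F G"
  shows "open U" "open V" "smooth_on U F" "smooth_on V G" "F ` U = V" "G ` V = U"
    and "\<And>x. x \<in> U \<Longrightarrow> G (F x) = x" "\<And>y. y \<in> V \<Longrightarrow> F (G y) = y"
    and "\<And>x. x \<in> U \<Longrightarrow> F x \<in> V" "\<And>y. y \<in> V \<Longrightarrow> G y \<in> U"
  using assms unfolding ambient_diffeo_def homeomorphism_def by auto

lemma submanifold_iff:
  fixes M :: "'a::euclidean_space set"
  shows "submanifold d M \<longleftrightarrow> (\<forall>p\<in>M. \<exists>U V \<phi> \<psi> W. ambient_diffeo U V \<phi> \<psi> \<and> p \<in> U \<and>
     subspace (W :: 'a set) \<and> dim W = d \<and> \<phi> ` (M \<inter> U) = V \<inter> W)"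
  unfolding submanifold_def ambient_diffeo_def by (simp only: conj_ac)

lemma submanifold_Times:
  fixes M :: "'a::euclidean_space set" and N :: "'b::euclidean_space set"
  assumes "submanifold c M" and "submanifold d N"
  shows "submanifold (c + d) (M \<times> N)"
  unfolding submanifold_iff
proof
  fix pq assume "pq \<in> M \<times> N"
  then obtain p q where pq: "pq = (p, q)" "p \<in> M" "q \<in> N" by blast
  from assms(1) pq(2) obtain U V \<phi> \<psi> and W :: "'a set" where
    1: "ambient_diffeo U V \<phi> \<psi>" "p \<in> U" "subspace W" "dim W = c" "\<phi> ` (M \<inter> U) = V \<inter> W"
    unfolding submanifold_iff by blast
  from assms(2) pq(3) obtain U' V' \<phi>' \<psi>' and W' :: "'b set" where
    2: "ambient_diffeo U' V' \<phi>' \<psi>'" "q \<in> U'" "subspace W'" "dim W' = d" "\<phi>' ` (N \<inter> U') = V' \<inter> W'"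
    unfolding submanifold_iff by blast
  note D1 = ambient_diffeoD[OF 1(1)] and D2 = ambient_diffeoD[OF 2(1)]
  have sm: "smooth_on (A \<times> B) (\<lambda>x. (f (fst x), g (snd x)))"
    if "open A" "open B" "smooth_on A f" "smooth_on B g"
    for A :: "'x::euclidean_space set" and B :: "'y::euclidean_space set" 
      and f :: "'x \<Rightarrow> 'x" and g :: "'y \<Rightarrow> 'y"
  proof (rule smooth_on_Pair)
    show op: "open (A \<times> B)" using that by (simp add: open_Times)
    show "smooth_on (A \<times> B) (\<lambda>x. f (fst x))"
      by (rule smooth_on_compose[OF op \<open>open A\<close> _ smooth_on_linear[OF bounded_linear_fst op smooth_on_ident[OF op]] that(3)]) auto
    show "smooth_on (A \<times> B) (\<lambda>x. g (snd x))"
      by (rule smooth_on_compose[OF op \<open>open B\<close> _ smooth_on_linear[OF bounded_linear_snd op smooth_on_ident[OF op]] that(4)]) auto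
  qed
  show "\<exists>U V \<phi> \<psi> W. ambient_diffeo U V \<phi> \<psi> \<and> pq \<in> U \<and>
     subspace (W :: ('a \<times> 'b) set) \<and> dim W = c + d \<and> \<phi> ` ((M \<times> N) \<inter> U) = V \<inter> W"
  proof (intro exI conjI)
    show "ambient_diffeo (U \<times> U') (V \<times> V') (\<lambda>x. (\<phi> (fst x), \<phi>' (snd x))) (\<lambda>y. (\<psi> (fst y), \<psi>' (snd y)))"
      by (rule ambient_diffeoI) (use D1 D2 in \<open>auto intro!: open_Times sm\<close>)
    show "pq \<in> U \<times> U'" using pq 1 2 by simp
    show "subspace (W \<times> W')" using 1 2 by (simp add: subspace_Times)
    show "dim (W \<times> W') = c + d" using 1 2 by (simp add: dim_Times)
    have "(\<lambda>x. (\<phi> (fst x), \<phi>' (snd x))) ` ((M \<times> N) \<inter> (U \<times> U'))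
        = \<phi> ` (M \<inter> U) \<times> \<phi>' ` (N \<inter> U')"
      by force
    then show "(\<lambda>x. (\<phi> (fst x), \<phi>' (snd x))) ` ((M \<times> N) \<inter> (U \<times> U')) = (V \<times> V') \<inter> (W \<times> W')"
      using 1(5) 2(5) by auto
  qed
qed

text \<open>
  A chart of \<open>N\<close> composed with \<open>F\<close> is a chart of the image, after both its domain and its range
  are cut down to the points that stay inside \<open>V\<close>.
\<close>

lemma submanifold_ambient_diffeo:
  fixes F :: "'a::euclidean_space \<Rightarrow> 'a"
  assumes dif: "ambient_diffeo U V F G" and "submanifold d N" and "N \<subseteq> V"
  shows "submanifold d (G ` N)"
  unfolding submanifold_iff
proof
  note D = ambient_diffeoD[OF dif]
  fix p assume "p \<in> G ` N"
  then obtain q where q: "q \<in> N" "q \<in> V" "p = G q" using \<open>N \<subseteq> V\<close> by blast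
  from assms(2) q(1) obtain A B \<phi> \<psi> and W :: "'a set" where
    1: "ambient_diffeo A B \<phi> \<psi>" "q \<in> A" "subspace W" "dim W = d" "\<phi> ` (N \<inter> A) = B \<inter> W"
    unfolding submanifold_iff by blast
  note E = ambient_diffeoD[OF 1(1)]
  define U' B' where "U' = G ` (V \<inter> A)" and "B' = \<phi> ` (V \<inter> A)"
  have U': "U' = {x\<in>U. F x \<in> A}"
    unfolding U'_def using D by (auto intro!: image_eqI[where f = G])
  have B': "B' = {y\<in>B. \<psi> y \<in> V}"
    unfolding B'_def using E by (auto intro!: image_eqI[where f = \<phi>])
  have "open U'"
    using continuous_open_preimage[OF smooth_on_imp_continuous_on[OF D(3)] D(1) E(1)] 
    by (simp add: U' Int_def vimage_def)
  have "open B'"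
    using continuous_open_preimage[OF smooth_on_imp_continuous_on[OF E(4)] E(2) D(2)] 
    by (simp add: B' Int_def vimage_def)
  show "\<exists>U V \<phi> \<psi> W. ambient_diffeo U V \<phi> \<psi> \<and> p \<in> U \<and>
     subspace (W :: 'a set) \<and> dim W = d \<and> \<phi> ` (G ` N \<inter> U) = V \<inter> W"
  proof (intro exI conjI)
    show "ambient_diffeo U' B' (\<lambda>x. \<phi> (F x)) (\<lambda>y. G (\<psi> y))"
    proof (rule ambient_diffeoI)
      show "smooth_on U' (\<lambda>x. \<phi> (F x))"
        by (rule smooth_on_compose[OF \<open>open U'\<close> E(1) _ smooth_on_subset[OF D(3)] E(3)])
          (auto simp: U')
      show "smooth_on B' (\<lambda>y. G (\<psi> y))"
        by (rule smooth_on_compose[OF \<open>open B'\<close> D(2) _ smooth_on_subset[OF E(4)] D(4)])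
          (auto simp: B')
    qed (use D E \<open>open U'\<close> \<open>open B'\<close> in \<open>auto simp: U' B'\<close>)
    show "p \<in> U'" unfolding U'_def using q 1 by blast
    show "subspace W" "dim W = d" by fact+
    have "G ` N \<inter> U' = G ` (N \<inter> A)"
      unfolding U' using D \<open>N \<subseteq> V\<close> by auto (metis IntI image_eqI subsetD)
    then have "(\<lambda>x. \<phi> (F x)) ` (G ` N \<inter> U') = \<phi> ` (N \<inter> A)"
      using D(8) \<open>N \<subseteq> V\<close> by (force simp: image_image intro!: image_cong)
    also have "\<dots> = B' \<inter> W"
    proof -
      have "\<phi> ` (N \<inter> A) \<subseteq> B'" unfolding B'_def using \<open>N \<subseteq> V\<close> by blast
      then show ?thesis using 1(5) B' by blast
    qed
    finally show "(\<lambda>x. \<phi> (F x)) ` (G ` N \<inter> U') = B' \<inter> W" .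
  qed
qed

lemma submanifold_UNIV: "submanifold DIM('a) (UNIV :: 'a::euclidean_space set)"
  unfolding submanifold_iff
proof
  fix p :: 'a
  have "ambient_diffeo UNIV UNIV (\<lambda>x::'a. x) (\<lambda>x. x)"
    by (rule ambient_diffeoI) (auto intro: smooth_on_ident)
  then show "\<exists>U V \<phi> \<psi> W. ambient_diffeo U V \<phi> \<psi> \<and> p \<in> U \<and>
     subspace W \<and> dim W = DIM('a) \<and> \<phi> ` (UNIV \<inter> U) = V \<inter> (W :: 'a set)"
    using dim_UNIV[where 'a = 'a] by (intro exI[of _ UNIV] exI[of _ "\<lambda>x. x"]) simp
qed

text \<open>
  Near \<open>p\<close> the sphere is flattened onto the hyperplane orthogonal to \<open>p\<close> by replacing the coordinate
  \<open>x \<bullet> p\<close> of a point by \<open>x \<bullet> x - 1\<close> and keeping the orthogonal part. On the half space \<open>x \<bullet> p > 0\<close>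
  the old coordinate is recovered as a square root, whose argument is the function \<open>r\<close>.
\<close>

lemma submanifold_sphere: "submanifold (DIM('a) - 1) (sphere 0 1 :: 'a::euclidean_space set)"
  unfolding submanifold_iff
proof
  fix p :: 'a assume "p \<in> sphere 0 1"
  then have pp: "p \<bullet> p = 1" by (simp add: norm_eq_1)
  define U where "U = {x. 0 < x \<bullet> p}"
  define r where "r = (\<lambda>y. 1 + y \<bullet> p - y \<bullet> y + (y \<bullet> p) * (y \<bullet> p))"
  define V where "V = {y. 0 < r y}"
  define \<phi> where "\<phi> = (\<lambda>x. x + (x \<bullet> x - 1 - x \<bullet> p) *\<^sub>R p)"
  define \<psi> where "\<psi> = (\<lambda>y. y + (sqrt (r y) - y \<bullet> p) *\<^sub>R p)"
  have cont: "continuous_on UNIV r" unfolding r_def by (intro continuous_intros)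
  have op: "open U" "open V"
    unfolding U_def V_def
    by (rule open_Collect_less; intro continuous_intros cont)+
  have sr: "smooth_on V r"
    unfolding r_def
    by (intro smooth_on_add smooth_on_diff smooth_on_mult smooth_on_inner smooth_on_const
        smooth_on_ident op)
  have \<phi>p: "\<phi> x \<bullet> p = x \<bullet> x - 1" for x
    unfolding \<phi>_def by (simp add: inner_add_left pp)
  have r\<phi>: "r (\<phi> x) = (x \<bullet> p)\<^sup>2" for x
    unfolding r_def \<phi>p
    by (simp add: \<phi>_def inner_add_left inner_add_right pp inner_commute[of p x])
      (simp add: algebra_simps power2_eq_square)
  have \<psi>p: "\<psi> y \<bullet> p = sqrt (r y)" for y
    unfolding \<psi>_def by (simp add: inner_add_left pp)
  have \<psi>\<psi>: "\<psi> y \<bullet> \<psi> y = 1 + y \<bullet> p" if "y \<in> V" for y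
  proof -
    have "sqrt (r y) * sqrt (r y) = r y" using that by (simp add: V_def)
    moreover have "\<psi> y \<bullet> \<psi> y = y \<bullet> y - (y \<bullet> p) * (y \<bullet> p) + sqrt (r y) * sqrt (r y)"
      unfolding \<psi>_def
      by (simp add: inner_add_left inner_add_right pp inner_commute[of p y])
        (simp add: algebra_simps)
    ultimately show ?thesis by (simp add: r_def)
  qed
  show "\<exists>U V \<phi> \<psi> W. ambient_diffeo U V \<phi> \<psi> \<and> p \<in> U \<and>
     subspace W \<and> dim W = DIM('a) - 1 \<and> \<phi> ` (sphere 0 1 \<inter> U) = V \<inter> (W :: 'a set)"
  proof (intro exI conjI)
    show dif: "ambient_diffeo U V \<phi> \<psi>"
    proof (rule ambient_diffeoI)
      show "smooth_on U \<phi>"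
        unfolding \<phi>_def
        by (intro smooth_on_add smooth_on_diff smooth_on_scaleR smooth_on_inner smooth_on_const
            smooth_on_ident op)
      have "smooth_on V (\<lambda>y. sqrt (r y))"
        by (rule smooth_on_compose[OF op(2) open_greaterThan _ sr smooth_on_sqrt]) (auto simp: V_def)
      then show "smooth_on V \<psi>"
        unfolding \<psi>_def
        by (intro smooth_on_add smooth_on_diff smooth_on_scaleR smooth_on_inner smooth_on_const
            smooth_on_ident op)
      show "\<phi> ` U \<subseteq> V" by (auto simp: U_def V_def r\<phi>)
      show "\<psi> ` V \<subseteq> U" by (auto simp: U_def V_def \<psi>p)
      show "\<psi> (\<phi> x) = x" if "x \<in> U" for x
        using that by (simp add: \<psi>_def r\<phi> \<phi>p U_def) (simp add: \<phi>_def algebra_simps)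
      show "\<phi> (\<psi> y) = y" if "y \<in> V" for y
        unfolding \<phi>_def \<psi>\<psi>[OF that] \<psi>p by (simp add: \<psi>_def algebra_simps)
    qed (rule op)+
    show "p \<in> U" by (simp add: U_def pp)
    show "subspace {y. p \<bullet> y = 0}" by (rule subspace_hyperplane)
    have "p \<noteq> 0" using pp by auto
    then show "dim {y. p \<bullet> y = 0} = DIM('a) - 1" by (rule dim_hyperplane)
    have "x \<in> sphere 0 1 \<longleftrightarrow> p \<bullet> \<phi> x = 0" for x
      by (simp add: \<phi>p inner_commute[of p] norm_eq_1)
    then show "\<phi> ` (sphere 0 1 \<inter> U) = V \<inter> {y. p \<bullet> y = 0}"
      using ambient_diffeoD[OF dif] by (auto simp del: mem_sphere_0)
  qed
qed

section \<open>Smooth maps on submanifolds, curves and tangent vectors\<close>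

lemma smooth_map_onI:
  "open U \<Longrightarrow> M \<subseteq> U \<Longrightarrow> smooth_on U f \<Longrightarrow> smooth_map_on M f"
  unfolding smooth_map_on_def by blast

lemma smooth_map_on_bilinear:
  assumes B: "bounded_bilinear B" and "smooth_map_on M f" "smooth_map_on M g"
  shows "smooth_map_on M (\<lambda>x. B (f x) (g x))"
  unfolding smooth_map_on_def
proof
  fix p assume "p \<in> M"
  with assms(2) obtain U f' where 1: "open U" "p \<in> U" "smooth_on U f'" "\<forall>x\<in>M \<inter> U. f' x = f x"
    unfolding smooth_map_on_def by blast
  from \<open>p \<in> M\<close> assms(3) obtain V g' where 2: "open V" "p \<in> V" "smooth_on V g'" "\<forall>x\<in>M \<inter> V. g' x = g x"
    unfolding smooth_map_on_def by blast
  have "smooth_on (U \<inter> V) (\<lambda>x. B (f' x) (g' x))"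
    by (rule smooth_on_bilinear[OF B open_Int[OF 1(1) 2(1)]
          smooth_on_subset[OF 1(3)] smooth_on_subset[OF 2(3)]]) auto
  then show "\<exists>U \<Phi>. open U \<and> p \<in> U \<and> smooth_on U \<Phi> \<and> (\<forall>x\<in>M \<inter> U. \<Phi> x = B (f x) (g x))"
    using 1 2 by (intro exI[of _ "U \<inter> V"] exI[of _ "\<lambda>x. B (f' x) (g' x)"]) auto
qed

lemma smooth_map_on_linear:
  assumes "bounded_linear L" and "smooth_map_on M f"
  shows "smooth_map_on M (\<lambda>x. L (f x))"
  unfolding smooth_map_on_def
proof
  fix p assume "p \<in> M"
  with assms(2) obtain U f' where 1: "open U" "p \<in> U" "smooth_on U f'" "\<forall>x\<in>M \<inter> U. f' x = f x"
    unfolding smooth_map_on_def by blast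
  then show "\<exists>U \<Phi>. open U \<and> p \<in> U \<and> smooth_on U \<Phi> \<and> (\<forall>x\<in>M \<inter> U. \<Phi> x = L (f x))"
    using smooth_on_linear[OF assms(1) 1(1,3)]
    by (intro exI[of _ U] exI[of _ "\<lambda>x. L (f' x)"]) auto
qed

lemma smooth_map_on_add:
  assumes "smooth_map_on M f" "smooth_map_on M g"
  shows "smooth_map_on M (\<lambda>x. f x + g x)"
  unfolding smooth_map_on_def
proof
  fix p assume "p \<in> M"
  with assms(1) obtain U f' where 1: "open U" "p \<in> U" "smooth_on U f'" "\<forall>x\<in>M \<inter> U. f' x = f x"
    unfolding smooth_map_on_def by blast
  from \<open>p \<in> M\<close> assms(2) obtain V g' where 2: "open V" "p \<in> V" "smooth_on V g'" "\<forall>x\<in>M \<inter> V. g' x = g x"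
    unfolding smooth_map_on_def by blast
  have "smooth_on (U \<inter> V) (\<lambda>x. f' x + g' x)"
    by (rule smooth_on_add[OF open_Int[OF 1(1) 2(1)]
          smooth_on_subset[OF 1(3)] smooth_on_subset[OF 2(3)]]) auto
  then show "\<exists>U \<Phi>. open U \<and> p \<in> U \<and> smooth_on U \<Phi> \<and> (\<forall>x\<in>M \<inter> U. \<Phi> x = f x + g x)"
    using 1 2 by (intro exI[of _ "U \<inter> V"] exI[of _ "\<lambda>x. f' x + g' x"]) auto
qed

lemma curve_at_map:
  assumes c: "curve_at M p v c" and U: "open U" "M \<subseteq> U" "smooth_on U F" and F: "F ` M \<subseteq> N"
  shows "curve_at N (F p) (frechet_derivative F (at p) v) (F \<circ> c)"
proof -
  from c obtain \<epsilon> where \<epsilon>: "\<epsilon> > 0" "smooth_on {-\<epsilon><..<\<epsilon>} c" "c ` {-\<epsilon><..<\<epsilon>} \<subseteq> M"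
    and c0: "c 0 = p" and cv: "(c has_vector_derivative v) (at 0)"
    unfolding curve_at_def by blast
  have "0 \<in> {-\<epsilon><..<\<epsilon>}" using \<epsilon>(1) by simp
  then have "p \<in> U" using \<epsilon>(3) c0 U(2) by blast
  have "smooth_on {-\<epsilon><..<\<epsilon>} (\<lambda>s. F (c s))"
    by (rule smooth_on_compose[OF open_greaterThanLessThan U(1) _ \<epsilon>(2) U(3)]) (use \<epsilon> U in blast)
  moreover have "(F \<circ> c has_vector_derivative frechet_derivative F (at p) v) (at 0)"
    using vector_derivative_diff_chain_within[OF cv, of F]
      smooth_on_has_derivative[OF U(3) \<open>p \<in> U\<close>] c0 has_derivative_at_withinI by blast
  ultimately show ?thesis
    unfolding curve_at_def using \<epsilon> F c0 by (auto simp: o_def intro!: exI[of _ \<epsilon>])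
qed

lemma tangent_space_map:
  assumes "v \<in> tangent_space M p" and "open U" "M \<subseteq> U" "smooth_on U F" and "F ` M \<subseteq> N"
  shows "frechet_derivative F (at p) v \<in> tangent_space N (F p)"
  using assms curve_at_map unfolding tangent_space_def by blast

text \<open>
  The definite description picks this vector because it serves all curves at once by the chain
  rule, and because a tangent vector comes with at least one curve, which pins the value down.
\<close>

lemma differential_on_eq:
  assumes v: "v \<in> tangent_space M p" and U: "open U" "M \<subseteq> U" "smooth_on U F"
  shows "differential_on M F p v = frechet_derivative F (at p) v"
  unfolding differential_on_def
proof (rule the_equality)
  have F: "(F \<circ> c has_vector_derivative frechet_derivative F (at p) v) (at 0)"
    if "curve_at M p v c" for c
    using curve_at_map[OF that U subset_UNIV] unfolding curve_at_def by blast
  then show "\<forall>c. curve_at M p v c \<longrightarrow>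
      ((F \<circ> c) has_vector_derivative frechet_derivative F (at p) v) (at 0)" by blast
  from v obtain c where c: "curve_at M p v c" unfolding tangent_space_def by blast
  fix w assume "\<forall>c. curve_at M p v c \<longrightarrow> ((F \<circ> c) has_vector_derivative w) (at 0)"
  with c F[OF c] show "w = frechet_derivative F (at p) v"
    using vector_derivative_unique_at by blast
qed

text \<open>
  Freezing one coordinate at its value at \<open>x\<close> maps \<open>M \<times> N\<close> into itself and fixes \<open>x\<close>, so its
  derivative preserves the tangent space at \<open>x\<close>.
\<close>

lemma tangent_space_Times:
  fixes M :: "'a::euclidean_space set" and N :: "'b::euclidean_space set"
  assumes "\<xi> \<in> tangent_space (M \<times> N) x" and "x \<in> M \<times> N"
  shows "(fst \<xi>, 0) \<in> tangent_space (M \<times> N) x" and "(0, snd \<xi>) \<in> tangent_space (M \<times> N) x"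
    and "snd \<xi> \<in> tangent_space N (snd x)"
proof -
  obtain p q where x: "x = (p, q)" "p \<in> M" "q \<in> N" using assms(2) by blast
  have 1: "(snd has_derivative snd) (at x)"
    and 2: "((\<lambda>y. (fst y, q)) has_derivative (\<lambda>y. (fst y, 0))) (at x)"
    and 3: "((\<lambda>y. (p, snd y)) has_derivative (\<lambda>y. (0, snd y))) (at x)"
    by (auto intro!: derivative_eq_intros)
  have sm: "smooth_on UNIV (fst :: 'a \<times> 'b \<Rightarrow> 'a)" "smooth_on UNIV (snd :: 'a \<times> 'b \<Rightarrow> 'b)"
    using smooth_on_linear[OF bounded_linear_fst open_UNIV smooth_on_ident[OF open_UNIV]]
      smooth_on_linear[OF bounded_linear_snd open_UNIV smooth_on_ident[OF open_UNIV]] by auto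
  note push = tangent_space_map[OF assms(1) open_UNIV subset_UNIV]
  show "snd \<xi> \<in> tangent_space N (snd x)"
    using push[OF sm(2), of N] frechet_derivative_at[OF 1] by auto
  show "(fst \<xi>, 0) \<in> tangent_space (M \<times> N) x"
    using push[OF smooth_on_Pair[OF open_UNIV sm(1) smooth_on_const], of q "M \<times> N"]
      frechet_derivative_at[OF 2, symmetric] x by (force simp: image_subset_iff)
  show "(0, snd \<xi>) \<in> tangent_space (M \<times> N) x"
    using push[OF smooth_on_Pair[OF open_UNIV smooth_on_const sm(2)], of p "M \<times> N"]
      frechet_derivative_at[OF 3, symmetric] x by (force simp: image_subset_iff)
qed

text \<open>
  Differentiate \<open>c s \<bullet> c s = 1\<close> along a curve \<open>c\<close> in the sphere.
\<close>

lemma tangent_space_sphere: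
  assumes "v \<in> tangent_space (sphere 0 1) p"
  shows "p \<bullet> v = 0"
proof -
  from assms obtain c \<epsilon> where \<epsilon>: "\<epsilon> > 0" "c ` {-\<epsilon><..<\<epsilon>} \<subseteq> sphere 0 1"
    and c0: "c 0 = p" and cv: "(c has_vector_derivative v) (at 0)"
    unfolding tangent_space_def curve_at_def by blast
  have "((\<lambda>s. c s \<bullet> c s) has_vector_derivative (c 0 \<bullet> v + v \<bullet> c 0)) (at 0)"
    by (rule bounded_bilinear.has_vector_derivative[OF bounded_bilinear_inner cv cv])
  moreover have "((\<lambda>s. c s \<bullet> c s) has_vector_derivative 0) (at 0)"
  proof (rule has_vector_derivative_transform_within_open[OF has_vector_derivative_const])
    show "open {-\<epsilon><..<\<epsilon>}" "0 \<in> {-\<epsilon><..<\<epsilon>}" using \<epsilon> by auto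
    show "1 = c s \<bullet> c s" if "s \<in> {-\<epsilon><..<\<epsilon>}" for s
      using \<epsilon>(2) that by (force simp: norm_eq_1)
  qed
  ultimately have "c 0 \<bullet> v + v \<bullet> c 0 = 0" by (rule vector_derivative_unique_at)
  then show ?thesis by (simp add: c0 inner_commute)
qed

section \<open>Isometries induced by ambient diffeomorphisms\<close>

lemma ambient_diffeo_derivative_cancel:
  fixes F :: "'a::euclidean_space \<Rightarrow> 'b::euclidean_space"
  assumes dif: "ambient_diffeo U V F G" and x: "x \<in> U"
  shows "frechet_derivative G (at (F x)) (frechet_derivative F (at x) v) = v"
proof -
  note D = ambient_diffeoD[OF dif]
  have "((\<lambda>x. G (F x)) has_derivative
      (\<lambda>v. frechet_derivative G (at (F x)) (frechet_derivative F (at x) v))) (at x)"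
    by (rule has_derivative_compose[OF smooth_on_has_derivative[OF D(3) x]
          smooth_on_has_derivative[OF D(4) D(9)[OF x]]])
  moreover have "((\<lambda>x. G (F x)) has_derivative (\<lambda>v. v)) (at x)"
    by (rule has_derivative_transform_within_open[OF has_derivative_ident D(1) x])
      (rule D(7)[symmetric])
  ultimately have
    "(\<lambda>v. frechet_derivative G (at (F x)) (frechet_derivative F (at x) v)) = (\<lambda>v. v)"
    by (rule has_derivative_unique)
  then show ?thesis by (rule fun_cong)
qed

text \<open>
  The form of \<open>M\<close> is one constant bilinear form of the ambient space, which makes bilinearity and
  smoothness immediate. Symmetry and nondegeneracy pass from \<open>N\<close> to \<open>M\<close>, since the derivatives of
  \<open>F\<close> and \<open>G\<close> are mutually inverse and map tangent spaces to tangent spaces. The isometry is \<open>F\<close>, and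
  the metric has to be compared only on the side of \<open>N\<close>, in terms of the parametrization \<open>G\<close>.
\<close>

lemma isometric_ambient_diffeo:
  fixes M N :: "'a::euclidean_space prm"
  assumes dif: "ambient_diffeo U V F G"
    and N: "pseudo_riemannian N" "points N \<subseteq> V"
    and M: "points M = G ` points N"
    and B: "bounded_bilinear B" and form: "\<And>p. form M p = B"
    and pullback: "\<And>q v w. q \<in> points N \<Longrightarrow> v \<in> tangent_space (points N) q \<Longrightarrow>
      w \<in> tangent_space (points N) q \<Longrightarrow>
      form N q v w = B (frechet_derivative G (at q) v) (frechet_derivative G (at q) w)"
  shows "isometric M N"
proof -
  note D = ambient_diffeoD[OF dif]
  interpret B: bounded_bilinear B by (rule B)
  have MU: "points M \<subseteq> U" unfolding M using N(2) D(10) by blast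
  have "F (G q) = q" if "q \<in> points N" for q
    using that N(2) D(8) by blast
  then have FM: "F ` points M = points N"
    unfolding M image_image by simp
  have inv: "G (F p) = p" "F p \<in> points N" if "p \<in> points M" for p
    using that MU D(7) FM by blast+
  have DF: "frechet_derivative F (at p) v \<in> tangent_space (points N) (F p)"
    if "v \<in> tangent_space (points M) p" for p v
    by (rule tangent_space_map[OF that D(1) MU D(3)]) (simp add: FM)
  have DG: "frechet_derivative G (at q) w \<in> tangent_space (points M) (G q)"
    if "w \<in> tangent_space (points N) q" for q w
    by (rule tangent_space_map[OF that D(2) N(2) D(4)]) (simp add: M)
  have DGF: "frechet_derivative G (at (F p)) (frechet_derivative F (at p) v) = v"
    if "p \<in> points M" for p v
    by (rule ambient_diffeo_derivative_cancel[OF dif subsetD[OF MU that]])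
  have metric: "form N (F p) (frechet_derivative F (at p) v) (frechet_derivative F (at p) w) = B v w"
    if "p \<in> points M" "v \<in> tangent_space (points M) p" "w \<in> tangent_space (points M) p" for p v w
    using pullback[OF inv(2) DF DF] that by (simp add: DGF)
  have "pseudo_riemannian M"
    unfolding pseudo_riemannian_def Let_def form
  proof (intro conjI ballI allI impI)
    from N(1) obtain d where "submanifold d (points N)" unfolding pseudo_riemannian_def by blast
    then show "\<exists>d. submanifold d (points M)"
      using submanifold_ambient_diffeo[OF dif _ N(2)] unfolding M by meson
  next
    fix p u v w and a b :: real
    show "B (a *\<^sub>R u + b *\<^sub>R v) w = a * B u w + b * B v w"
      by (simp add: B.add_left B.scaleR_left)
  next
    fix p v w
    assume p: "p \<in> points M"
      and v: "v \<in> tangent_space (points M) p" and w: "w \<in> tangent_space (points M) p"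
    have "form N (F p) (frechet_derivative F (at p) v) (frechet_derivative F (at p) w)
        = form N (F p) (frechet_derivative F (at p) w) (frechet_derivative F (at p) v)"
      using N(1) inv(2)[OF p] DF[OF v] DF[OF w] unfolding pseudo_riemannian_def Let_def by blast
    then show "B v w = B w v" using metric p v w by simp
  next
    fix p v
    assume p: "p \<in> points M" and v: "v \<in> tangent_space (points M) p"
      and 0: "\<forall>w\<in>tangent_space (points M) p. B v w = 0"
    have "form N (F p) (frechet_derivative F (at p) v) w = 0"
      if "w \<in> tangent_space (points N) (F p)" for w
    proof -
      have "frechet_derivative G (at (F p)) w \<in> tangent_space (points M) p"
        using DG[OF that] inv(1)[OF p] by simp
      with 0 show ?thesis
        using pullback[OF inv(2)[OF p] DF[OF v] that] by (simp add: DGF[OF p])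
    qed
    then have "frechet_derivative F (at p) v = 0"
      using N(1) inv(2)[OF p] DF[OF v] unfolding pseudo_riemannian_def Let_def by blast
    moreover have "linear (frechet_derivative G (at (F p)))"
      using smooth_on_has_derivative[OF D(4)] inv(2)[OF p] N(2) has_derivative_linear by blast
    ultimately show "v = 0" using DGF[OF p, of v] linear_0[of "frechet_derivative G (at (F p))"] by simp
  next
    fix X Y
    assume "smooth_vector_field (points M) X \<and> smooth_vector_field (points M) Y"
    then show "smooth_map_on (points M) (\<lambda>p. B (X p) (Y p))"
      unfolding smooth_vector_field_def using smooth_map_on_bilinear[OF B, of "points M" X Y] by simp
  qed
  moreover have "isometry M N F"
    unfolding isometry_def diffeomorphism_on_def
  proof (intro conjI ballI)
    have inj: "inj_on F (points M)" by (rule inj_on_inverseI[where g = G]) (rule inv(1))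
    then show "bij_betw F (points M) (points N)" by (simp add: bij_betw_def FM)
    show "smooth_map_on (points M) F" by (rule smooth_map_onI[OF D(1) MU D(3)])
    show "smooth_map_on (points N) (inv_into (points M) F)"
      unfolding smooth_map_on_def
    proof (intro ballI exI conjI)
      fix q assume "q \<in> points N"
      then show "q \<in> V" using N(2) by blast
      show "G y = inv_into (points M) F y" if "y \<in> points N \<inter> V" for y
        using that inj M D(8) by (auto intro!: inv_into_f_eq[symmetric])
    qed (rule D)+
    fix p v w
    assume "p \<in> points M" "v \<in> tangent_space (points M) p" "w \<in> tangent_space (points M) p"
    then show "form N (F p) (differential_on (points M) F p v) (differential_on (points M) F p w)
        = form M p v w"
      using metric by (simp add: differential_on_eq[OF _ D(1) MU D(3)] form)
  qed
  ultimately show ?thesis using N(1) unfolding isometric_def by blast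
qed

section \<open>The line, the sphere and their warped product\<close>

lemma pseudo_riemannian_round_sphere: "pseudo_riemannian (round_sphere :: (real ^ 'm::finite) prm)"
  unfolding pseudo_riemannian_def Let_def round_sphere_def prm.simps
proof (intro conjI ballI allI impI)
  show "\<exists>d. submanifold d (sphere 0 1 :: (real ^ 'm) set)"
    using submanifold_sphere by blast
next
  fix X Y :: "real ^ 'm \<Rightarrow> real ^ 'm"
  assume "smooth_vector_field (sphere 0 1) X \<and> smooth_vector_field (sphere 0 1) Y"
  then show "smooth_map_on (sphere 0 1) (\<lambda>p. X p \<bullet> Y p)"
    unfolding smooth_vector_field_def
    using smooth_map_on_bilinear[OF bounded_bilinear_inner, of "sphere 0 1" X Y] by simp
qed (auto simp: inner_add_left inner_add_right inner_commute)

lemma pseudo_riemannian_line: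
  assumes "smooth_on UNIV \<beta>" and "\<And>t. \<beta> t \<noteq> 0"
  shows "pseudo_riemannian (line_manifold \<beta>)"
  unfolding pseudo_riemannian_def Let_def line_manifold_def prm.simps
proof (intro conjI ballI allI impI)
  show "\<exists>d. submanifold d (UNIV :: real set)" using submanifold_UNIV by blast
next
  fix t v assume "v \<in> tangent_space UNIV t" "\<forall>w\<in>tangent_space UNIV t. \<beta> t * (v * w) = 0"
  then have "\<beta> t * (v * v) = 0" by blast
  then show "v = 0" using assms(2)[of t] by simp
next
  fix X Y :: "real \<Rightarrow> real"
  assume XY: "smooth_vector_field UNIV X \<and> smooth_vector_field UNIV Y"
  show "smooth_map_on UNIV (\<lambda>p. \<beta> p * (X p * Y p))"
    by (intro smooth_map_on_bilinear[OF bounded_bilinear_mult] smooth_map_onI[OF open_UNIV _ assms(1)])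
      (use XY in \<open>auto simp: smooth_vector_field_def\<close>)
qed (auto simp: algebra_simps)

lemma pseudo_riemannian_warped_product_line_sphere:
  assumes \<beta>: "smooth_on UNIV \<beta>" "\<And>t. \<beta> t \<noteq> 0" and k: "smooth_on UNIV k" "\<And>t. k t \<noteq> 0"
  shows "pseudo_riemannian
    (warped_product (line_manifold \<beta>) k (round_sphere :: (real ^ 'm::finite) prm))"
  unfolding pseudo_riemannian_def Let_def warped_product_def line_manifold_def round_sphere_def prm.simps
proof (intro conjI ballI allI impI)
  show "\<exists>d. submanifold d (UNIV \<times> sphere 0 1 :: (real \<times> (real ^ 'm)) set)"
    using submanifold_Times[OF submanifold_UNIV submanifold_sphere] by blast
next
  fix p v :: "real \<times> (real ^ 'm)"
  assume p: "p \<in> UNIV \<times> sphere 0 1" and v: "v \<in> tangent_space (UNIV \<times> sphere 0 1) p"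
    and 0: "\<forall>w\<in>tangent_space (UNIV \<times> sphere 0 1) p.
      \<beta> (fst p) * (fst v * fst w) + (k (fst p))\<^sup>2 * (snd v \<bullet> snd w) = 0"
  \<comment> \<open>Pair \<open>v\<close> with its own two components, which are tangent to the product.\<close>
  from tangent_space_Times(1,2)[OF v p] 0
  have "\<beta> (fst p) * (fst v * fst v) = 0" "(k (fst p))\<^sup>2 * (snd v \<bullet> snd v) = 0" by force+
  then show "v = 0" using \<beta>(2)[of "fst p"] k(2)[of "fst p"] by (simp add: prod_eq_iff)
next
  let ?N = "UNIV \<times> sphere 0 1 :: (real \<times> (real ^ 'm)) set"
  fix X Y :: "real \<times> (real ^ 'm) \<Rightarrow> real \<times> (real ^ 'm)"
  assume "smooth_vector_field ?N X \<and> smooth_vector_field ?N Y"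
  then have XY: "smooth_map_on ?N X" "smooth_map_on ?N Y" by (auto simp: smooth_vector_field_def)
  have base: "smooth_map_on ?N (\<lambda>p. f (fst p))" if "smooth_on UNIV f" for f :: "real \<Rightarrow> real"
    using smooth_on_compose[OF open_UNIV open_UNIV subset_UNIV
        smooth_on_linear[OF bounded_linear_fst open_UNIV smooth_on_ident[OF open_UNIV]] that]
    by (intro smooth_map_onI[OF open_UNIV]) auto
  note mult = smooth_map_on_bilinear[OF bounded_bilinear_mult]
  show "smooth_map_on ?N (\<lambda>p. \<beta> (fst p) * (fst (X p) * fst (Y p))
      + (k (fst p))\<^sup>2 * (snd (X p) \<bullet> snd (Y p)))"
    unfolding power2_eq_square
    by (intro smooth_map_on_add mult base \<beta>(1) k(1)
        smooth_map_on_bilinear[OF bounded_bilinear_inner]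
        smooth_map_on_linear[OF bounded_linear_fst] smooth_map_on_linear[OF bounded_linear_snd] XY)
qed (auto simp: algebra_simps inner_add_left inner_add_right inner_commute)

section \<open>The hypersurface as a warped product\<close>

lemma minkowski_inner: "minkowski v w = - (fst v * fst w) + snd v \<bullet> snd w"
  by (simp add: minkowski_def inner_vec_def)

text \<open>
  Reflecting the time component of the first argument turns the Minkowski form into the Euclidean
  inner product.
\<close>

lemma bounded_bilinear_minkowski:
  "bounded_bilinear (minkowski :: real \<times> (real ^ 'm::finite) \<Rightarrow> _)"
proof -
  have "bounded_linear (\<lambda>v :: real \<times> (real ^ 'm). (- fst v, snd v))"
    by (intro bounded_linear_Pair bounded_linear_minus bounded_linear_fst bounded_linear_snd)
  from bounded_bilinear.comp1[OF bounded_bilinear_inner this]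
  have "bounded_bilinear (\<lambda>v w :: real \<times> (real ^ 'm). (- fst v, snd v) \<bullet> w)" .
  moreover have "minkowski = (\<lambda>v w :: real \<times> (real ^ 'm). (- fst v, snd v) \<bullet> w)"
    by (intro ext) (simp add: minkowski_inner inner_prod_def)
  ultimately show ?thesis by simp
qed

lemma Psi_hat_smooth:
  assumes "\<alpha> \<in> Psi_hat"
  shows "smooth_on UNIV \<alpha>" "\<And>t. \<alpha> t > 0" "smooth_on UNIV (h_of \<alpha>)" "\<And>t. deriv (h_of \<alpha>) t \<noteq> 0"
    "smooth_on UNIV (\<lambda>t. \<alpha> t * cosh t)" "smooth_on UNIV (\<lambda>t. (deriv \<alpha> t)\<^sup>2 - (\<alpha> t)\<^sup>2)"
    "\<And>t. (deriv \<alpha> t)\<^sup>2 - (\<alpha> t)\<^sup>2 \<noteq> 0"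
proof -
  show sm: "smooth_on UNIV \<alpha>" and pos: "\<And>t. \<alpha> t > 0" and "\<And>t. deriv (h_of \<alpha>) t \<noteq> 0"
    using assms unfolding Psi_hat_def Psi_def by auto
  show "smooth_on UNIV (h_of \<alpha>)"
    unfolding h_of_def[abs_def] by (rule smooth_on_mult[OF open_UNIV sm smooth_on_sinh_cosh(1)])
  show "smooth_on UNIV (\<lambda>t. \<alpha> t * cosh t)"
    by (rule smooth_on_mult[OF open_UNIV sm smooth_on_sinh_cosh(2)])
  show "smooth_on UNIV (\<lambda>t. (deriv \<alpha> t)\<^sup>2 - (\<alpha> t)\<^sup>2)"
    unfolding power2_eq_square
    by (intro smooth_on_diff smooth_on_mult open_UNIV sm smooth_on_deriv(2)[OF sm])
  show "(deriv \<alpha> t)\<^sup>2 - (\<alpha> t)\<^sup>2 \<noteq> 0" for t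
  proof -
    have "\<bar>deriv \<alpha> t\<bar> \<noteq> \<bar>\<alpha> t\<bar>" using assms pos[of t] unfolding Psi_hat_def by auto
    then show ?thesis by (simp add: abs_eq_iff power2_eq_iff)
  qed
qed


definition dS_param :: "(real \<Rightarrow> real) \<Rightarrow> real \<times> (real ^ 'm) \<Rightarrow> real \<times> (real ^ 'm)" where
  "dS_param \<alpha> x = (h_of \<alpha> (fst x), (\<alpha> (fst x) * cosh (fst x)) *\<^sub>R snd x)"

definition dS_coord :: "(real \<Rightarrow> real) \<Rightarrow> real \<times> (real ^ 'm) \<Rightarrow> real \<times> (real ^ 'm)" where
  "dS_coord \<alpha> x = (let t = inv (h_of \<alpha>) (fst x) in (t, inverse (\<alpha> t * cosh t) *\<^sub>R snd x))"

lemma ambient_diffeo_dS_param: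
  assumes "\<alpha> \<in> Psi_hat"
  shows "ambient_diffeo (range (h_of \<alpha>) \<times> (UNIV :: (real ^ 'm::finite) set)) UNIV
    (dS_coord \<alpha>) (dS_param \<alpha>)"
proof (rule ambient_diffeoI)
  note \<alpha> = Psi_hat_smooth[OF assms]
  note h = smooth_inverse_function[OF \<alpha>(3,4)]
  let ?U = "range (h_of \<alpha>) \<times> (UNIV :: (real ^ 'm) set)"
  have cancel: "inverse (\<alpha> t * cosh t) * (\<alpha> t * cosh t) = 1"
    "(\<alpha> t * cosh t) * inverse (\<alpha> t * cosh t) = 1" for t
    using \<alpha>(2)[of t] by (simp_all add: field_simps)
  show U: "open ?U" by (intro open_Times h(2) open_UNIV)
  have fs: "smooth_on S fst" "smooth_on S snd" if "open S" for S :: "(real \<times> (real ^ 'm)) set"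
    using that smooth_on_linear[OF bounded_linear_fst that smooth_on_ident[OF that]]
      smooth_on_linear[OF bounded_linear_snd that smooth_on_ident[OF that]] by simp_all
  show "smooth_on UNIV (dS_param \<alpha> :: _ \<Rightarrow> real \<times> (real ^ 'm))"
    unfolding dS_param_def[abs_def]
    by (intro smooth_on_Pair smooth_on_scaleR open_UNIV fs
        smooth_on_compose[OF open_UNIV open_UNIV subset_UNIV fs(1)[OF open_UNIV] \<alpha>(3)]
        smooth_on_compose[OF open_UNIV open_UNIV subset_UNIV fs(1)[OF open_UNIV] \<alpha>(5)])
  have t: "smooth_on ?U (\<lambda>x. inv (h_of \<alpha>) (fst x))"
    by (rule smooth_on_compose[OF U h(2) _ fs(1)[OF U] h(3)]) auto
  have k: "smooth_on ?U (\<lambda>x. \<alpha> (inv (h_of \<alpha>) (fst x)) * cosh (inv (h_of \<alpha>) (fst x)))"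
    by (rule smooth_on_compose[OF U open_UNIV subset_UNIV t \<alpha>(5)])
  have "smooth_on ?U (\<lambda>x. inverse (\<alpha> (inv (h_of \<alpha>) (fst x)) * cosh (inv (h_of \<alpha>) (fst x))))"
  proof (rule smooth_on_compose[OF U _ _ k smooth_on_inverse])
    show "(\<lambda>x. \<alpha> (inv (h_of \<alpha>) (fst x)) * cosh (inv (h_of \<alpha>) (fst x))) ` ?U \<subseteq> - {0}"
      using \<alpha>(2)[THEN less_imp_neq, THEN not_sym] by auto
  qed auto
  then show "smooth_on ?U (dS_coord \<alpha>)"
    unfolding dS_coord_def[abs_def] Let_def
    by (intro smooth_on_Pair smooth_on_scaleR U fs t)
  show "dS_coord \<alpha> (dS_param \<alpha> x) = x" for x :: "real \<times> (real ^ 'm)"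
    using h(1)
    by (simp add: dS_coord_def dS_param_def Let_def cancel del: inverse_mult_distrib)
  show "dS_param \<alpha> (dS_coord \<alpha> x) = x" if "x \<in> ?U" for x
  proof -
    define t where "t = inv (h_of \<alpha>) (fst x)"
    have "h_of \<alpha> t = fst x" unfolding t_def using that by (auto intro: f_inv_into_f)
    then show ?thesis
      by (simp add: dS_coord_def dS_param_def Let_def cancel del: inverse_mult_distrib flip: t_def)
  qed
qed (auto simp: dS_param_def)

text \<open>
  At \<open>dS_param \<alpha> (t, z)\<close> the defining equation of the hypersurface says
  \<open>(\<alpha> t cosh t)\<^sup>2 (z \<bullet> z - 1) = 0\<close>, that is, \<open>z\<close> lies on the unit sphere.
\<close>

lemma points_dS_eq:
  assumes "\<alpha> \<in> Psi_hat"
  shows "points (dS (range (h_of \<alpha>)) (f_of \<alpha>) :: (real \<times> (real ^ 'm::finite)) prm)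
    = dS_param \<alpha> ` (UNIV \<times> sphere 0 1)"
proof -
  note \<alpha> = Psi_hat_smooth[OF assms]
  note h = smooth_inverse_function[OF \<alpha>(3,4)]
  have dif: "ambient_diffeo (range (h_of \<alpha>) \<times> (UNIV :: (real ^ 'm) set)) UNIV (dS_coord \<alpha>) (dS_param \<alpha>)"
    by (rule ambient_diffeo_dS_param[OF assms])
  have key: "dS_param \<alpha> x \<in> points (dS (range (h_of \<alpha>)) (f_of \<alpha>)) \<longleftrightarrow> x \<in> UNIV \<times> sphere 0 1"
    for x :: "real \<times> (real ^ 'm)"
  proof -
    obtain t z where x: "x = (t, z)" by (cases x)
    have "minkowski (dS_param \<alpha> x) (dS_param \<alpha> x) - (\<alpha> t)\<^sup>2
        = (\<alpha> t)\<^sup>2 * ((cosh t)\<^sup>2 * (z \<bullet> z) - ((sinh t)\<^sup>2 + 1))"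
      by (simp add: x dS_param_def minkowski_inner h_of_def algebra_simps power2_eq_square)
    also have "(sinh t)\<^sup>2 + 1 = (cosh t)\<^sup>2" by (simp add: cosh_square_eq)
    also have "(\<alpha> t)\<^sup>2 * ((cosh t)\<^sup>2 * (z \<bullet> z) - (cosh t)\<^sup>2) = (\<alpha> t * cosh t)\<^sup>2 * (z \<bullet> z - 1)"
      by (simp add: algebra_simps power_mult_distrib)
    finally have "minkowski (dS_param \<alpha> x) (dS_param \<alpha> x) = (\<alpha> t)\<^sup>2 \<longleftrightarrow>
        (\<alpha> t * cosh t)\<^sup>2 * (z \<bullet> z - 1) = 0" by auto
    also have "\<dots> \<longleftrightarrow> z \<bullet> z = 1" using \<alpha>(2)[of t] by auto
    finally show ?thesis
      using h(1) by (simp add: x dS_def f_of_def dS_param_def norm_eq_1)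
  qed
  show ?thesis
  proof (intro equalityI subsetI)
    fix y assume y: "y \<in> points (dS (range (h_of \<alpha>)) (f_of \<alpha>) :: (real \<times> (real ^ 'm)) prm)"
    then have "y = dS_param \<alpha> (dS_coord \<alpha> y)"
      by (intro ambient_diffeoD(7)[OF dif, symmetric]) (cases y, simp add: dS_def)
    with y key[of "dS_coord \<alpha> y"] show "y \<in> dS_param \<alpha> ` (UNIV \<times> sphere 0 1)" by auto
  qed (use key in blast)
qed

text \<open>
  Here the warped product metric appears: the hypotheses on \<open>z\<close> are those of a point of the unit
  sphere and of tangent vectors to it.
\<close>

lemma minkowski_derivative_dS_param:
  assumes "\<alpha> \<in> Psi_hat" and z: "z \<bullet> z = 1" "z \<bullet> snd v = 0" "z \<bullet> snd w = 0"
  shows "minkowski (frechet_derivative (dS_param \<alpha>) (at (t, z)) v)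
      (frechet_derivative (dS_param \<alpha>) (at (t, z)) w)
    = ((deriv \<alpha> t)\<^sup>2 - (\<alpha> t)\<^sup>2) * (fst v * fst w) + (\<alpha> t * cosh t)\<^sup>2 * (snd v \<bullet> snd w)"
proof -
  define h' k' where "h' = deriv \<alpha> t * sinh t + \<alpha> t * cosh t"
    and "k' = deriv \<alpha> t * cosh t + \<alpha> t * sinh t"
  have D\<alpha>: "(\<alpha> has_field_derivative deriv \<alpha> t) (at t)"
    by (rule smooth_on_deriv(1)[OF Psi_hat_smooth(1)[OF assms(1)]])
  have 1: "(h_of \<alpha> has_derivative (*) h') (at t)"
    unfolding h_of_def[abs_def] has_field_derivative_def[symmetric] h'_def
    by (rule derivative_eq_intros D\<alpha> refl | simp)+
  have 2: "((\<lambda>t. \<alpha> t * cosh t) has_derivative (*) k') (at t)"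
    unfolding has_field_derivative_def[symmetric] k'_def
    by (rule derivative_eq_intros D\<alpha> refl | simp)+
  have fst: "(fst has_derivative fst) (at (t, z))" and snd: "(snd has_derivative snd) (at (t, z))"
    by (auto intro!: derivative_eq_intros)
  have "(dS_param \<alpha> has_derivative
      (\<lambda>v. (h' * fst v, (\<alpha> t * cosh t) *\<^sub>R snd v + (k' * fst v) *\<^sub>R z))) (at (t, z))"
    unfolding dS_param_def[abs_def]
    using has_derivative_Pair[OF has_derivative_compose[OF fst, of "h_of \<alpha>" "(*) h'"]
      has_derivative_scaleR[OF has_derivative_compose[OF fst, of "\<lambda>t. \<alpha> t * cosh t" "(*) k'"] snd]] 1 2
    by simp
  note D = frechet_derivative_at[OF this, symmetric]
  have "minkowski (h' * fst v, (\<alpha> t * cosh t) *\<^sub>R snd v + (k' * fst v) *\<^sub>R z)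
      (h' * fst w, (\<alpha> t * cosh t) *\<^sub>R snd w + (k' * fst w) *\<^sub>R z)
    = (k'\<^sup>2 - h'\<^sup>2) * (fst v * fst w) + (\<alpha> t * cosh t)\<^sup>2 * (snd v \<bullet> snd w)"
    using z by (simp add: minkowski_inner inner_add_left inner_add_right inner_commute[of "snd v" z]
        inner_commute[of "snd w" z])
      (simp add: algebra_simps power2_eq_square)
  moreover have "k'\<^sup>2 - h'\<^sup>2 = ((deriv \<alpha> t)\<^sup>2 - (\<alpha> t)\<^sup>2) * ((cosh t)\<^sup>2 - (sinh t)\<^sup>2)"
    unfolding k'_def h'_def by (simp add: algebra_simps power2_eq_square)
  moreover have "(cosh t)\<^sup>2 - (sinh t)\<^sup>2 = 1" by (simp add: cosh_square_eq)
  ultimately show ?thesis by (simp add: D)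
qed

theorem corollary3p7:
  fixes n :: nat and \<alpha> :: "real \<Rightarrow> real"
  assumes "n \<ge> 1" and "CARD('m::finite) = n + 1"
    and "\<alpha> \<in> Psi_hat"
  shows "let \<beta> = (\<lambda>t. (deriv \<alpha> t)\<^sup>2 - (\<alpha> t)\<^sup>2);
             k = (\<lambda>t. \<alpha> t * cosh t);
             B = line_manifold \<beta>;
             F = (round_sphere :: (real ^ 'm) prm)
         in pseudo_riemannian B \<and> pseudo_riemannian F \<and>
            smooth_on UNIV k \<and> (\<forall>t. k t > 0) \<and>
            isometric (dS (range (h_of \<alpha>)) (f_of \<alpha>) :: (real \<times> (real ^ 'm)) prm)
              (warped_product B k F)"
proof -
  note \<alpha> = Psi_hat_smooth[OF assms(3)]
  define \<beta> where "\<beta> = (\<lambda>t. (deriv \<alpha> t)\<^sup>2 - (\<alpha> t)\<^sup>2)"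
  define k where "k = (\<lambda>t. \<alpha> t * cosh t)"
  let ?N = "warped_product (line_manifold \<beta>) k (round_sphere :: (real ^ 'm) prm)"
  have \<beta>: "smooth_on UNIV \<beta>" "\<beta> t \<noteq> 0" for t unfolding \<beta>_def by (rule \<alpha>)+
  have k: "smooth_on UNIV k" unfolding k_def by (rule \<alpha>)
  have kpos: "k t > 0" for t unfolding k_def using \<alpha>(2) by simp
  have points_N: "points ?N = UNIV \<times> sphere 0 1"
    by (simp add: warped_product_def line_manifold_def round_sphere_def)
  have "isometric (dS (range (h_of \<alpha>)) (f_of \<alpha>) :: (real \<times> (real ^ 'm)) prm) ?N"
  proof (rule isometric_ambient_diffeo[OF ambient_diffeo_dS_param[OF assms(3)] _ subset_UNIV _
        bounded_bilinear_minkowski])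
    show "pseudo_riemannian ?N"
      using kpos by (intro pseudo_riemannian_warped_product_line_sphere \<beta> k) (metis less_irrefl)
    show "points (dS (range (h_of \<alpha>)) (f_of \<alpha>) :: (real \<times> (real ^ 'm)) prm)
        = dS_param \<alpha> ` points ?N"
      unfolding points_N by (rule points_dS_eq[OF assms(3)])
    show "form (dS (range (h_of \<alpha>)) (f_of \<alpha>) :: (real \<times> (real ^ 'm)) prm) p = minkowski" for p
      by (simp add: dS_def)
    fix q v w
    assume q: "q \<in> points ?N"
      and "v \<in> tangent_space (points ?N) q" "w \<in> tangent_space (points ?N) q"
    then have vw: "snd q \<bullet> snd v = 0" "snd q \<bullet> snd w = 0"
      using tangent_space_Times(3) tangent_space_sphere unfolding points_N by blast+
    have "snd q \<bullet> snd q = 1" using q unfolding points_N by (auto simp: norm_eq_1)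
    from minkowski_derivative_dS_param[OF assms(3) this vw, of "fst q"]
    show "form ?N q v w = minkowski (frechet_derivative (dS_param \<alpha>) (at q) v)
        (frechet_derivative (dS_param \<alpha>) (at q) w)"
      by (simp add: warped_product_def line_manifold_def round_sphere_def \<beta>_def k_def)
  qed
  then show ?thesis
    using pseudo_riemannian_line[OF \<beta>] pseudo_riemannian_round_sphere k kpos
    unfolding Let_def \<beta>_def k_def by blast
qed

end
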